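(* Let $K$ be a commutative ring and let $F$ be a combinatorial species (a functor from finite sets and bijections to finite sets) with $F(\emptyset)=\emptyset$. In the ring $K_F[[\Sigma]]$, we have the exponential relation $$\sum_{m\ge0}g_mt^m=\exp\Big(\sum_{i\ge1}c_it^i\Big),$$ where $g_m\in K_F(m)$ is the constant function $1$ on $\mathrm{Asm}_F([m])$ and $c_m\in K_F(m)$ is the characteristic function of $F([m])\subseteq\mathrm{Asm}_F([m])$.
   Context: A partition $\Lambda=(X,\sim_\Lambda)$ is a finite set with an equivalence relation; its classes are called blocks. $\Gamma\le\Lambda$ means $\Gamma$ is a partition of the same set refining $\Lambda$; $\Lambda\sqcup\Lambda'$ is the disjoint union; $\underline m$ is $[m]=\{1,\dots,m\}$ with the indiscrete relation. $\Sigma_\Lambda$ is the group of bijections of $X$ preserving every block; $\Sigma_m=\Sigma_{\underline m}$. For a finite set $X$, the set of $F$-assemblies on $X$ is $\mathrm{Asm}_F(X)=\coprod_{\Gamma}\prod_{B}F(B)$, the coproduct over partitions $\Gamma$ of $X$ and the product over blocks $B$ of $\Gamma$ (so an assembly is a partition of $X$ with an $F$-structure on each block; $F(X)$ embeds, for $X$ nonempty, as the assemblies with one block; $\mathrm{Asm}_F(\emptyset)$ is a point). For a partition $\Lambda$ of $X$, $\mathrm{Asm}_F(\Lambda)=\prod_{B}\mathrm{Asm}_F(B)$ over blocks $B$ of $\Lambda$, identified with the subset of $\mathrm{Asm}_F(X)$ of assemblies whose partition refines $\Lambda$; $\Sigma_\Lambda$ acts by transport of structure. Set $$K_F(\Lambda)=\mathrm{Map}(\mathrm{Asm}_F(\Lambda),K)^{\Sigma_\Lambda},\qquad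 K_F(m)=K_F(\underline m).$$ For $\Omega\le\Lambda$, the transfer $K_F(\Omega)\to K_F(\Lambda)$ sends $\varphi$ to $\sum_{[\sigma]\in\Sigma_\Lambda/\Sigma_\Omega}\sigma\widetilde\varphi$, where $\widetilde\varphi$ is the extension of $\varphi$ by zero along $\mathrm{Asm}_F(\Omega)\subseteq\mathrm{Asm}_F(\Lambda)$ and $(\sigma\psi)(a)=\psi(\sigma^{-1}a)$. The external product of $\varphi\in K_F(\Lambda)$ and $\psi\in K_F(\Lambda')$ is the function $\varphi\boxtimes\psi\in K_F(\Lambda\sqcup\Lambda')$, $(a,b)\mapsto\varphi(a)\psi(b)$, via $\mathrm{Asm}_F(\Lambda)\times\mathrm{Asm}_F(\Lambda')\cong\mathrm{Asm}_F(\Lambda\sqcup\Lambda')$. $K_F[[\Sigma]]=\prod_{m\ge0}K_F(m)$ is a commutative ring under the transfer product: for $x\in K_F(i)$, $y\in K_F(j)$, $xy\in K_F(i+j)$ is the transfer along $\underline i\sqcup\underline j\le\underline{i+j}$ (first $i$ and last $j$ elements) of $x\boxtimes y$. Elements are written $\sum_mx_mt^m$ with $x_m\in K_F(m)$, $t$ tracking the grading. The exponential is interpreted integrally: when $K=\mathbb Z$ the groups $\mathbb Z_F(m)$ are torsion-free and $\exp(\sum_ic_it^i)=\sum_n\frac1{n!}(\sum_ic_it^i)^n$ is computed in $\mathbb Q_F[[\Sigma]]\supseteq\mathbb Z_F[[\Sigma]]$, where it has coefficients in $\mathbb Z_F$; for general $K$ it is the image under the ring map $\mathbb Z_F[[\Sigma]]\to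 K_F[[\Sigma]]$ induced by $\mathbb Z\to K$. *)

theory Defs
  imports
    Complex_Main
    "HOL-Algebra.IntRing"
    "HOL-Algebra.Left_Coset"
    "HOL-Library.Disjoint_Sets"
    "HOL-Library.Groups_Big_Fun"
    "HOL-Combinatorics.Permutations"
begin

text \<open>
  The morphism part of a species takes the source of a bijection and the bijection itself;
  a bijection out of \<open>A\<close> is represented by any function which is injective on \<open>A\<close>, and only
  its values on \<open>A\<close> matter. The type of structures is arbitrary.
\<close>

record ('a, 's) species =
  structs :: "'a set \<Rightarrow> 's set"
  transport :: "'a set \<Rightarrow> ('a \<Rightarrow> 'a) \<Rightarrow> 's \<Rightarrow> 's"

locale species =
  fixes F :: "('a, 's) species"
  assumes finite_structs: "finite A \<Longrightarrow> finite (structs F A)"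
    and transport_closed:
      "\<lbrakk>finite A; bij_betw f A B; s \<in> structs F A\<rbrakk> \<Longrightarrow> transport F A f s \<in> structs F B"
    and transport_cong:
      "\<lbrakk>finite A; inj_on f A; \<And>x. x \<in> A \<Longrightarrow> f x = g x; s \<in> structs F A\<rbrakk>
        \<Longrightarrow> transport F A f s = transport F A g s"
    and transport_id: "\<lbrakk>finite A; s \<in> structs F A\<rbrakk> \<Longrightarrow> transport F A id s = s"
    and transport_comp:
      "\<lbrakk>finite A; inj_on f A; inj_on g (f ` A); s \<in> structs F A\<rbrakk>
        \<Longrightarrow> transport F A (g \<circ> f) s = transport F (f ` A) g (transport F A f s)"

text \<open>
  A partition is given by its set \<open>\<Lambda>\<close> of blocks, so that its underlying set is \<open>\<Union>\<Lambda>\<close>.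
  The disjoint union of partitions of disjoint sets is then \<open>\<Lambda> \<union> \<Lambda>'\<close>.
  The indiscrete partition of the empty set has no blocks.
\<close>

definition indiscrete :: "'a set \<Rightarrow> 'a set set" where
  "indiscrete X = X // (X \<times> X)"

definition block_perms :: "'a set set \<Rightarrow> ('a \<Rightarrow> 'a) monoid" where
  "block_perms \<Lambda> =
    \<lparr>carrier = {\<sigma>. \<sigma> permutes \<Union>\<Lambda> \<and> (\<forall>B\<in>\<Lambda>. \<sigma> ` B = B)}, mult = (\<circ>), one = id\<rparr>"

type_synonym ('a, 's) assembly = "'a set set \<times> ('a set \<Rightarrow> 's)"

text \<open>
  \<open>Asm F \<Lambda>\<close> is the product over the blocks of \<open>\<Lambda>\<close> of the sets of assemblies on the block,
  realised inside the assemblies on \<open>\<Union>\<Lambda>\<close>; all assemblies on \<open>X\<close> are \<open>Asm F (indiscrete X)\<close>.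
\<close>

definition Asm :: "('a, 's) species \<Rightarrow> 'a set set \<Rightarrow> ('a, 's) assembly set" where
  "Asm F \<Lambda> = {(P, s). refines (\<Union>\<Lambda>) P \<Lambda> \<and> s \<in> Pi\<^sub>E P (structs F)}"

text \<open>The image of \<open>F(X)\<close> in the assemblies on a nonempty set \<open>X\<close>.\<close>

definition one_block :: "('a, 's) species \<Rightarrow> 'a set \<Rightarrow> ('a, 's) assembly set" where
  "one_block F X = (\<lambda>s. ({X}, \<lambda>B\<in>{X}. s)) ` structs F X"

text \<open>
  Transport of an assembly along \<open>\<sigma>\<close>, which has to be injective on the underlying set
  \<open>\<Union>P\<close>; the block \<open>B\<close> of the image comes from the block \<open>\<sigma> -` B \<inter> \<Union>P\<close>.
\<close>

definition relabel ::
    "('a, 's) species \<Rightarrow> ('a \<Rightarrow> 'a) \<Rightarrow> ('a, 's) assembly \<Rightarrow> ('a, 's) assembly" where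
  "relabel F \<sigma> = (\<lambda>(P, s).
    ((`) \<sigma> ` P,
     \<lambda>B\<in>(`) \<sigma> ` P. transport F (\<sigma> -` B \<inter> \<Union>P) \<sigma> (s (\<sigma> -` B \<inter> \<Union>P))))"

definition asm_restrict :: "'a set \<Rightarrow> ('a, 's) assembly \<Rightarrow> ('a, 's) assembly" where
  "asm_restrict X = (\<lambda>(P, s). ({B \<in> P. B \<subseteq> X}, restrict s {B \<in> P. B \<subseteq> X}))"

text \<open>
  The function \<open>\<sigma>\<psi>\<close> on \<open>Asm F \<Lambda>\<close>. Besides \<open>\<sigma>\<close> in \<open>block_perms \<Lambda>\<close> and \<open>\<psi>\<close> a function on
  \<open>Asm F \<Lambda>\<close>, this is also used to carry a function along an injection \<open>\<sigma>\<close> which maps the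
  partition on which \<open>\<psi>\<close> lives to the partition \<open>\<Lambda>\<close> of another set.
\<close>

definition act ::
    "('a, 's) species \<Rightarrow> 'a set set \<Rightarrow> ('a \<Rightarrow> 'a) \<Rightarrow> (('a, 's) assembly \<Rightarrow> 'k)
      \<Rightarrow> ('a, 's) assembly \<Rightarrow> 'k" where
  "act F \<Lambda> \<sigma> \<psi> = (\<lambda>a\<in>Asm F \<Lambda>. \<psi> (relabel F (inv_into UNIV \<sigma>) a))"

definition inv_funs ::
    "('k, 'z) ring_scheme \<Rightarrow> ('a, 's) species \<Rightarrow> 'a set set
      \<Rightarrow> (('a, 's) assembly \<Rightarrow> 'k) set" where
  "inv_funs K F \<Lambda> =
    {\<phi> \<in> Asm F \<Lambda> \<rightarrow>\<^sub>E carrier K. \<forall>\<sigma>\<in>carrier (block_perms \<Lambda>). act F \<Lambda> \<sigma> \<phi> = \<phi>}"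

definition extend_zero ::
    "('k, 'z) ring_scheme \<Rightarrow> ('a, 's) species \<Rightarrow> 'a set set \<Rightarrow> 'a set set
      \<Rightarrow> (('a, 's) assembly \<Rightarrow> 'k) \<Rightarrow> ('a, 's) assembly \<Rightarrow> 'k" where
  "extend_zero K F \<Omega> \<Lambda> \<phi> = (\<lambda>a\<in>Asm F \<Lambda>. if a \<in> Asm F \<Omega> then \<phi> a else \<zero>\<^bsub>K\<^esub>)"

text \<open>
  For \<open>\<phi>\<close> in \<open>inv_funs K F \<Omega>\<close> the summand does not depend on the representative of the coset.
\<close>

definition transfer ::
    "('k, 'z) ring_scheme \<Rightarrow> ('a, 's) species \<Rightarrow> 'a set set \<Rightarrow> 'a set set
      \<Rightarrow> (('a, 's) assembly \<Rightarrow> 'k) \<Rightarrow> ('a, 's) assembly \<Rightarrow> 'k" where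
  "transfer K F \<Omega> \<Lambda> \<phi> = (\<lambda>a\<in>Asm F \<Lambda>.
    \<Oplus>\<^bsub>K\<^esub>C\<in>lcosets\<^bsub>block_perms \<Lambda>\<^esub> (carrier (block_perms \<Omega>)).
      act F \<Lambda> (SOME \<sigma>. \<sigma> \<in> C) (extend_zero K F \<Omega> \<Lambda> \<phi>) a)"

definition ext_prod ::
    "('k, 'z) ring_scheme \<Rightarrow> ('a, 's) species \<Rightarrow> 'a set set \<Rightarrow> 'a set set
      \<Rightarrow> (('a, 's) assembly \<Rightarrow> 'k) \<Rightarrow> (('a, 's) assembly \<Rightarrow> 'k)
      \<Rightarrow> ('a, 's) assembly \<Rightarrow> 'k" where
  "ext_prod K F \<Lambda> \<Lambda>' \<phi> \<psi> = (\<lambda>a\<in>Asm F (\<Lambda> \<union> \<Lambda>').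
    \<phi> (asm_restrict (\<Union>\<Lambda>) a) \<otimes>\<^bsub>K\<^esub> \<psi> (asm_restrict (\<Union>\<Lambda>') a))"

abbreviation std :: "nat \<Rightarrow> nat set set" where
  "std m \<equiv> indiscrete {1..m}"

text \<open>
  The second factor \<open>y\<close> lives on \<open>{1..j}\<close> and is first carried to the last \<open>j\<close> elements
  of \<open>{1..i + j}\<close> along the shift by \<open>i\<close>.
\<close>

definition transfer_prod ::
    "('k, 'z) ring_scheme \<Rightarrow> (nat, 's) species \<Rightarrow> nat \<Rightarrow> nat
      \<Rightarrow> ((nat, 's) assembly \<Rightarrow> 'k) \<Rightarrow> ((nat, 's) assembly \<Rightarrow> 'k)
      \<Rightarrow> (nat, 's) assembly \<Rightarrow> 'k" where
  "transfer_prod K F i j x y =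
    (let \<Lambda> = std i; \<Lambda>' = indiscrete {i + 1..i + j} in
      transfer K F (\<Lambda> \<union> \<Lambda>') (std (i + j))
        (ext_prod K F \<Lambda> \<Lambda>' x (act F \<Lambda>' (\<lambda>k. i + k) y)))"

text \<open>The coefficient of \<open>t\<^sup>m\<close> in the series \<open>x\<close> is \<open>x m\<close>.\<close>

definition series_ring ::
    "('k, 'z) ring_scheme \<Rightarrow> (nat, 's) species
      \<Rightarrow> (nat \<Rightarrow> (nat, 's) assembly \<Rightarrow> 'k) ring" where
  "series_ring K F =
    \<lparr>carrier = {x. \<forall>m. x m \<in> inv_funs K F (std m)},
     mult = (\<lambda>x y m. \<lambda>a\<in>Asm F (std m).
       \<Oplus>\<^bsub>K\<^esub>i\<in>{..m}. transfer_prod K F i (m - i) (x i) (y (m - i)) a),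
     one = (\<lambda>m. \<lambda>a\<in>Asm F (std m). if m = 0 then \<one>\<^bsub>K\<^esub> else \<zero>\<^bsub>K\<^esub>),
     zero = (\<lambda>m. \<lambda>a\<in>Asm F (std m). \<zero>\<^bsub>K\<^esub>),
     add = (\<lambda>x y m. \<lambda>a\<in>Asm F (std m). x m a \<oplus>\<^bsub>K\<^esub> y m a)\<rparr>"

text \<open>The map on series induced by the unique ring homomorphism from \<open>\<int>\<close> to \<open>K\<close>.\<close>

definition base_change ::
    "('k, 'z) ring_scheme \<Rightarrow> (nat, 's) species \<Rightarrow> (nat \<Rightarrow> (nat, 's) assembly \<Rightarrow> int)
      \<Rightarrow> nat \<Rightarrow> (nat, 's) assembly \<Rightarrow> 'k" where
  "base_change K F x = (\<lambda>m. \<lambda>a\<in>Asm F (std m). [x m a] \<cdot>\<^bsub>K\<^esub> \<one>\<^bsub>K\<^esub>)"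

abbreviation rat_ring :: "rat ring" where
  "rat_ring \<equiv> \<lparr>carrier = UNIV, mult = (*), one = 1, zero = 0, add = (+)\<rparr>"

text \<open>
  For \<open>x\<close> without constant term, the \<open>n\<close>-th power of \<open>x\<close> vanishes in degrees below \<open>n\<close>,
  so that the coefficientwise sums over all \<open>n\<close> have finite support.
\<close>

definition rat_exp ::
    "(nat, 's) species \<Rightarrow> (nat \<Rightarrow> (nat, 's) assembly \<Rightarrow> rat)
      \<Rightarrow> nat \<Rightarrow> (nat, 's) assembly \<Rightarrow> rat" where
  "rat_exp F x = (\<lambda>m. \<lambda>a\<in>Asm F (std m).
    Sum_any (\<lambda>n. (1 / fact n) * (x [^]\<^bsub>series_ring rat_ring F\<^esub> (n::nat)) m a))"

definition int_exp ::
    "(nat, 's) species \<Rightarrow> (nat \<Rightarrow> (nat, 's) assembly \<Rightarrow> int)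
      \<Rightarrow> nat \<Rightarrow> (nat, 's) assembly \<Rightarrow> int" where
  "int_exp F x = (THE y. y \<in> carrier (series_ring \<Z> F) \<and>
    base_change rat_ring F y = rat_exp F (base_change rat_ring F x))"

text \<open>
  Over a general \<open>K\<close> there is no division by \<open>n!\<close>: the exponential of the image in
  \<open>series_ring K F\<close> of an integral series \<open>x\<close> is the image of the integral exponential of \<open>x\<close>.
\<close>

definition series_exp ::
    "('k, 'z) ring_scheme \<Rightarrow> (nat, 's) species \<Rightarrow> (nat \<Rightarrow> (nat, 's) assembly \<Rightarrow> int)
      \<Rightarrow> nat \<Rightarrow> (nat, 's) assembly \<Rightarrow> 'k" where
  "series_exp K F x = base_change K F (int_exp F x)"

definition const_one ::
    "('k, 'z) ring_scheme \<Rightarrow> (nat, 's) species \<Rightarrow> nat \<Rightarrow> (nat, 's) assembly \<Rightarrow> 'k" where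
  "const_one K F m = (\<lambda>a\<in>Asm F (std m). \<one>\<^bsub>K\<^esub>)"

definition char_fun ::
    "('k, 'z) ring_scheme \<Rightarrow> (nat, 's) species \<Rightarrow> nat \<Rightarrow> (nat, 's) assembly \<Rightarrow> 'k" where
  "char_fun K F m =
    (\<lambda>a\<in>Asm F (std m). if a \<in> one_block F {1..m} then \<one>\<^bsub>K\<^esub> else \<zero>\<^bsub>K\<^esub>)"

definition g_series ::
    "('k, 'z) ring_scheme \<Rightarrow> (nat, 's) species \<Rightarrow> nat \<Rightarrow> (nat, 's) assembly \<Rightarrow> 'k" where
  "g_series K F = (\<lambda>m. const_one K F m)"

definition c_series ::
    "('k, 'z) ring_scheme \<Rightarrow> (nat, 's) species \<Rightarrow> nat \<Rightarrow> (nat, 's) assembly \<Rightarrow> 'k" where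
  "c_series K F =
    (\<lambda>i. if 1 \<le> i then char_fun K F i else \<zero>\<^bsub>series_ring K F\<^esub> i)"

end

theory Submission
  imports Defs
begin

text \<open>
  Multiplying a series by \<open>c\<close> sums over the subsets \<open>S\<close> of the underlying set of an assembly,
  because a coset of \<open>\<Sigma>\<^sub>i \<times> \<Sigma>\<^sub>j\<close> is determined by the image \<open>S\<close> of the last \<open>j\<close> points; the
  term of \<open>S\<close> vanishes unless \<open>S\<close> is a block, and is then the value at the assembly with this
  block removed. Hence \<open>c\<^sup>n\<close> takes the value \<open>n!\<close> (the number of orderings of the blocks) on
  assemblies with \<open>n\<close> blocks and \<open>0\<close> on all others, so that \<open>c\<^sup>n / n!\<close> is the characteristic
  function of the assemblies with \<open>n\<close> blocks, and these add up to the constant function \<open>1\<close>.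
\<close>

section \<open>Indiscrete partitions and the assemblies on a set\<close>

lemma Union_indiscrete [simp]: "\<Union>(indiscrete X) = X"
  by (auto simp: indiscrete_def quotient_def)

lemma indiscrete_eq: "indiscrete X = (if X = {} then {} else {X})"
  by (auto simp: indiscrete_def quotient_def)

lemma partition_on_indiscrete: "partition_on X (indiscrete X)"
  by (auto simp: indiscrete_eq partition_on_def)

lemma refines_indiscrete_iff: "refines X P (indiscrete X) \<longleftrightarrow> partition_on X P"
  by (auto simp: refines_def partition_on_indiscrete)
    (auto simp: indiscrete_eq partition_on_def split: if_splits)

lemma image_indiscrete: "(`) f ` indiscrete X = indiscrete (f ` X)"
  by (auto simp: indiscrete_eq)

text \<open>Blocks are nonempty and disjoint, so a block equal to \<open>X\<close> leaves room for
  no other. For empty \<open>X\<close> both sides are false, which later covers degree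
  \<open>j = 0\<close>.\<close>

lemma card_eq_1_partition_iff:
  assumes "partition_on X P"
  shows "card P = 1 \<longleftrightarrow> X \<in> P"
proof
  assume "card P = 1"
  then obtain B where "P = {B}" by (auto simp: card_1_singleton_iff)
  then show "X \<in> P" using partition_onD1[OF assms] by simp
next
  assume X: "X \<in> P"
  have "B = X" if B: "B \<in> P" for B
  proof (rule ccontr)
    assume "B \<noteq> X"
    then have "B \<inter> X = {}" using partition_onD2[OF assms] B X by (auto simp: disjoint_def)
    moreover have "B \<subseteq> X" using partition_onD1[OF assms] B by blast
    ultimately have "B = {}" by (simp add: Int_absorb2)
    with B show False using partition_onD3[OF assms] by simp
  qed
  with X have "P = {X}" by blast
  then show "card P = 1" by simp
qed

lemma Asm_indiscrete_iff:
  "a \<in> Asm F (indiscrete X) \<longleftrightarrow> partition_on X (fst a) \<and> snd a \<in> Pi\<^sub>E (fst a) (structs F)"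
  by (cases a) (simp add: Asm_def refines_indiscrete_iff)

lemma partition_on_Asm: "a \<in> Asm F \<Lambda> \<Longrightarrow> partition_on (\<Union>\<Lambda>) (fst a)"
  by (auto simp: Asm_def refines_def)

text \<open>The condition on the structures does not mention the ambient partition, so only
  refinement is left to check.\<close>

lemma Asm_coarsen_iff:
  assumes "a \<in> Asm F \<Lambda>" "\<Union>\<Omega> = \<Union>\<Lambda>"
  shows "a \<in> Asm F \<Omega> \<longleftrightarrow> refines (\<Union>\<Omega>) (fst a) \<Omega>"
  using assms by (cases a) (auto simp: Asm_def)

text \<open>Makes the characteristic function of \<open>F(X)\<close> a function of the number of
  blocks.\<close>

lemma one_block_iff:
  assumes a: "a \<in> Asm F (indiscrete X)" and F: "structs F {} = {}"
  shows "a \<in> one_block F X \<longleftrightarrow> card (fst a) = 1"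
proof -
  obtain P s where [simp]: "a = (P, s)" by (cases a)
  have P: "partition_on X P" and s: "s \<in> Pi\<^sub>E P (structs F)"
    using a by (auto simp: Asm_indiscrete_iff)
  show ?thesis
  proof
    assume "a \<in> one_block F X"
    then show "card (fst a) = 1" by (auto simp: one_block_def)
  next
    assume "card (fst a) = 1"
    then have PX: "P = {X}" using card_eq_1_partition_iff[OF P] by (auto simp: card_1_singleton_iff)
    then have "s = (\<lambda>B\<in>{X}. s X)" "s X \<in> structs F X"
      using s by (auto simp: PiE_def extensional_def restrict_def fun_eq_iff)
    with PX show "a \<in> one_block F X" by (auto simp: one_block_def)
  qed
qed

section \<open>Relabelling and restricting assemblies\<close>

lemma fst_relabel [simp]: "fst (relabel F \<sigma> a) = (`) \<sigma> ` fst a"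
  by (simp add: relabel_def split_beta)

lemma card_image_image:
  assumes "inj_on f (\<Union>P)"
  shows "card ((`) f ` P) = card P"
  by (intro card_image inj_onI)
    (metis Union_upper assms inj_on_image_eq_iff)

lemma partition_on_image:
  assumes "partition_on A P" "inj_on f A"
  shows "partition_on (f ` A) ((`) f ` P)"
proof -
  \<comment> \<open>\<open>partition_on_inj_image\<close> deletes the empty set from the image
    family; here there is nothing to delete.\<close>
  have "{} \<notin> (`) f ` P" using assms(1) by (auto simp: partition_on_def)
  then show ?thesis using partition_on_inj_image[OF assms] by simp
qed

text \<open>Injectivity is asked only on the underlying set: besides permutations, the lemma serves
  for the inverse of the shift by \<open>i\<close>, which is meaningful only on the range of the
  shift.\<close>

lemma (in species) relabel_in_Asm:
  assumes a: "a \<in> Asm F \<Lambda>" and fin: "finite (\<Union>\<Lambda>)" and inj: "inj_on \<sigma> (\<Union>\<Lambda>)"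
  shows "relabel F \<sigma> a \<in> Asm F ((`) \<sigma> ` \<Lambda>)"
proof -
  obtain P s where [simp]: "a = (P, s)" by (cases a)
  have P: "partition_on (\<Union>\<Lambda>) P" and L: "partition_on (\<Union>\<Lambda>) \<Lambda>"
    and sub: "\<forall>X\<in>P. \<exists>Y\<in>\<Lambda>. X \<subseteq> Y" and s: "s \<in> Pi\<^sub>E P (structs F)"
    using a by (auto simp: Asm_def refines_def)
  have UP: "\<Union>P = \<Union>\<Lambda>" using P by (simp add: partition_on_def)
  have U: "\<Union>((`) \<sigma> ` \<Lambda>) = \<sigma> ` \<Union>\<Lambda>" by auto
  have "refines (\<sigma> ` \<Union>\<Lambda>) ((`) \<sigma> ` P) ((`) \<sigma> ` \<Lambda>)"
    unfolding refines_def
    using partition_on_image[OF P inj] partition_on_image[OF L inj] sub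
    by (simp add: image_mono) (meson image_mono)
  moreover have "transport F (\<sigma> -` \<sigma> ` C \<inter> \<Union>P) \<sigma> (s (\<sigma> -` \<sigma> ` C \<inter> \<Union>P)) \<in> structs F (\<sigma> ` C)"
    if C: "C \<in> P" for C
  proof -
    have CU: "C \<subseteq> \<Union>\<Lambda>" using C UP by auto
    have "\<sigma> -` \<sigma> ` C \<inter> \<Union>P = C"
      using inj CU unfolding UP by (auto dest: inj_onD)
    moreover have "finite C" using CU fin finite_subset by blast
    moreover have "bij_betw \<sigma> C (\<sigma> ` C)" using inj CU by (simp add: bij_betw_def inj_on_subset)
    moreover have "s C \<in> structs F C" using s C by auto
    ultimately show ?thesis by (simp add: transport_closed)
  qed
  ultimately show ?thesis
    by (auto simp: Asm_def relabel_def U)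
qed

text \<open>A block meeting \<open>\<Union>\<Gamma>\<close> lies in a block of
  \<open>\<Lambda>\<close>, which by disjointness is the block of \<open>\<Gamma>\<close> that it
  meets. So the blocks contained in \<open>\<Union>\<Gamma>\<close> already cover it.\<close>

lemma asm_restrict_in_Asm:
  assumes a: "a \<in> Asm F \<Lambda>" and sub: "\<Gamma> \<subseteq> \<Lambda>"
  shows "asm_restrict (\<Union>\<Gamma>) a \<in> Asm F \<Gamma>"
proof -
  obtain P s where [simp]: "a = (P, s)" by (cases a)
  have P: "partition_on (\<Union>\<Lambda>) P" and L: "partition_on (\<Union>\<Lambda>) \<Lambda>"
    and ref: "\<And>B. B \<in> P \<Longrightarrow> \<exists>Y\<in>\<Lambda>. B \<subseteq> Y" and s: "s \<in> Pi\<^sub>E P (structs F)"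
    using a by (auto simp: Asm_def refines_def)
  have in_block: "\<exists>Y\<in>\<Gamma>. B \<subseteq> Y" if B: "B \<in> P" and x: "x \<in> B" "x \<in> \<Union>\<Gamma>" for B x
  proof -
    obtain Y Y' where Y: "Y \<in> \<Lambda>" "B \<subseteq> Y" "Y' \<in> \<Gamma>" "x \<in> Y'" using ref[OF B] x by blast
    then have "Y = Y'" using partition_onD2[OF L] sub x by (auto simp: disjoint_def)
    with Y show ?thesis by blast
  qed
  have ref': "\<exists>Y\<in>\<Gamma>. B \<subseteq> Y" if B: "B \<in> P" "B \<subseteq> \<Union>\<Gamma>" for B
  proof -
    obtain x where "x \<in> B" using partition_onD3[OF P] B by (metis all_not_in_conv)
    with in_block[OF B(1)] B(2) show ?thesis by blast
  qed
  have "\<Union>{B \<in> P. B \<subseteq> \<Union>\<Gamma>} = \<Union>\<Gamma>"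
  proof
    show "\<Union>\<Gamma> \<subseteq> \<Union>{B \<in> P. B \<subseteq> \<Union>\<Gamma>}"
    proof
      fix x assume x: "x \<in> \<Union>\<Gamma>"
      then have "x \<in> \<Union>\<Lambda>" using sub by blast
      then have "x \<in> \<Union>P" by (simp only: partition_onD1[OF P])
      then obtain B where B: "B \<in> P" "x \<in> B" by blast
      then have "B \<subseteq> \<Union>\<Gamma>" using in_block[OF B x] by blast
      with B show "x \<in> \<Union>{B \<in> P. B \<subseteq> \<Union>\<Gamma>}" by blast
    qed
  qed auto
  then have "partition_on (\<Union>\<Gamma>) {B \<in> P. B \<subseteq> \<Union>\<Gamma>}"
    using P by (auto simp: partition_on_def disjoint_def)
  moreover have "partition_on (\<Union>\<Gamma>) \<Gamma>"
    using L sub by (auto simp: partition_on_def disjoint_def)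
  ultimately have "refines (\<Union>\<Gamma>) {B \<in> P. B \<subseteq> \<Union>\<Gamma>} \<Gamma>"
    using ref' unfolding refines_def by blast
  then show ?thesis using s by (simp add: Asm_def asm_restrict_def PiE_iff)
qed

lemma (in species) relabel_inv_in_Asm:
  assumes "a \<in> Asm F (indiscrete X)" "finite X" "\<sigma> permutes X"
  shows "relabel F (inv_into UNIV \<sigma>) a \<in> Asm F (indiscrete X)"
proof -
  have p: "inv_into UNIV \<sigma> permutes X" using assms(3) by (rule permutes_inv)
  show ?thesis
    using relabel_in_Asm[of a "indiscrete X" "inv_into UNIV \<sigma>"] assms(1,2) p
    by (simp add: image_indiscrete permutes_image permutes_inj_on)
qed

text \<open>All coefficients occurring in the proof are functions of the number of blocks alone.\<close>

lemma (in species) card_blocks_fun_in_inv_funs: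
  assumes u: "\<And>n. u n \<in> carrier K" and "finite X"
  shows "(\<lambda>a\<in>Asm F (indiscrete X). u (card (fst a))) \<in> inv_funs K F (indiscrete X)"
proof -
  have "act F (indiscrete X) \<sigma> (\<lambda>a\<in>Asm F (indiscrete X). u (card (fst a))) a
      = (\<lambda>a\<in>Asm F (indiscrete X). u (card (fst a))) a"
    if "\<sigma> \<in> carrier (block_perms (indiscrete X))" for \<sigma> a
  proof (cases "a \<in> Asm F (indiscrete X)")
    case True
    have s: "\<sigma> permutes X" using that by (simp add: block_perms_def)
    have "inj_on (inv_into UNIV \<sigma>) (\<Union>(fst a))"
      using permutes_inj_on[OF permutes_inv[OF s]] .
    with True relabel_inv_in_Asm[OF True assms(2) s] show ?thesis
      by (simp add: act_def card_image_image)
  qed (simp add: act_def)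
  with u show ?thesis by (auto simp: inv_funs_def)
qed

section \<open>Left cosets of the block-preserving permutations\<close>

text \<open>A bijection from \<open>J\<close> to \<open>S\<close> and one between the complements,
  which have equal size too, are glued and extended by the identity outside
  \<open>X\<close>.\<close>

lemma exists_permutes_image:
  assumes fin: "finite X" and "J \<subseteq> X" "S \<subseteq> X" "card S = card J"
  shows "\<exists>\<sigma>. \<sigma> permutes X \<and> \<sigma> ` J = S"
proof -
  have fJ: "finite J" "finite S" using assms finite_subset by auto
  obtain f where f: "bij_betw f J S"
    using finite_same_card_bij[OF fJ] assms by auto
  have "card (X - J) = card (X - S)" using assms fJ by (simp add: card_Diff_subset)
  then obtain g where g: "bij_betw g (X - J) (X - S)"
    using finite_same_card_bij[of "X - J" "X - S"] fin by auto
  define h where "h x = (if x \<in> J then f x else if x \<in> X then g x else x)" for x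
  have hJ: "bij_betw h J S" using f by (rule bij_betw_cong[THEN iffD1, rotated]) (simp add: h_def)
  moreover have "bij_betw h (X - J) (X - S)"
    using g by (rule bij_betw_cong[THEN iffD1, rotated]) (simp add: h_def)
  ultimately have "bij_betw h (J \<union> (X - J)) (S \<union> (X - S))"
    by (intro bij_betw_combine) auto
  moreover have "J \<union> (X - J) = X" "S \<union> (X - S) = X" using assms by auto
  moreover have "h x = x" if "x \<notin> X" for x using that assms by (auto simp: h_def)
  ultimately have "h permutes X" by (metis bij_imp_permutes)
  with hJ show ?thesis by (auto simp: bij_betw_def)
qed

lemma carrier_block_perms_indiscrete: "carrier (block_perms (indiscrete X)) = {\<sigma>. \<sigma> permutes X}"
  by (cases "X = {}") (simp_all add: block_perms_def indiscrete_eq permutes_image cong: conj_cong)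

text \<open>The block-preserving permutations form the stabiliser of \<open>J\<close> in the
  symmetric group of \<open>I \<union> J\<close>, so the left cosets correspond to the points of the
  orbit of \<open>J\<close>, that is, to the subsets of the same size.\<close>

lemma lcosets_block_perms:
  assumes fin: "finite I" "finite J" and disj: "I \<inter> J = {}"
  shows "lcosets\<^bsub>block_perms (indiscrete (I \<union> J))\<^esub> (carrier (block_perms (indiscrete I \<union> indiscrete J)))
    = (\<lambda>S. {\<rho>. \<rho> permutes I \<union> J \<and> \<rho> ` J = S}) ` {S. S \<subseteq> I \<union> J \<and> card S = card J}"
proof -
  let ?X = "I \<union> J"
  let ?H = "carrier (block_perms (indiscrete I \<union> indiscrete J))"
  let ?C = "\<lambda>S. {\<rho>. \<rho> permutes ?X \<and> \<rho> ` J = S}"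
  have H: "h \<in> ?H \<longleftrightarrow> h permutes ?X \<and> h ` J = J" for h
  proof -
    \<comment> \<open>\<open>I\<close> is the complement of \<open>J\<close>, so preserving
      \<open>J\<close> is the only condition left.\<close>
    have "h ` I = I" if "h permutes ?X" "h ` J = J"
    proof -
      have "I = ?X - J" using disj by blast
      then have "h ` I = h ` ?X - h ` J" by (metis image_set_diff permutes_inj[OF that(1)])
      also have "\<dots> = ?X - J" by (simp only: permutes_image[OF that(1)] that(2))
      finally show ?thesis using disj by blast
    qed
    moreover have "h \<in> ?H \<longleftrightarrow> h permutes ?X \<and> h ` I = I \<and> h ` J = J"
      by (auto simp add: block_perms_def indiscrete_eq simp del: image_Un)
    ultimately show ?thesis by blast
  qed
  have coset: "\<sigma> <#\<^bsub>block_perms (indiscrete ?X)\<^esub> ?H = ?C (\<sigma> ` J)" if s: "\<sigma> permutes ?X" for \<sigma>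
  proof -
    have "\<sigma> <#\<^bsub>block_perms (indiscrete ?X)\<^esub> ?H = (\<circ>) \<sigma> ` ?H"
      by (auto simp: l_coset_def block_perms_def)
    also have "\<dots> = ?C (\<sigma> ` J)"
    proof safe
      fix h assume h: "h \<in> ?H"
      show "\<sigma> \<circ> h permutes ?X" using h s by (simp add: H permutes_compose)
      have "h ` J = J" using h by (simp add: H)
      then have e: "(\<sigma> \<circ> h) ` J = \<sigma> ` J" by (simp only: image_comp[symmetric])
      show "(\<sigma> \<circ> h) x \<in> \<sigma> ` J" if "x \<in> J" for x using e that by blast
      show "\<sigma> x \<in> (\<sigma> \<circ> h) ` J" if "x \<in> J" for x using e that by blast
    next
      fix \<rho> assume r: "\<rho> permutes ?X" "\<rho> ` J = \<sigma> ` J"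
      \<comment> \<open>This composite is the element of the stabiliser by which
        \<open>\<rho>\<close> differs from \<open>\<sigma>\<close>.\<close>
      have "(inv_into UNIV \<sigma> \<circ> \<rho>) ` J = J"
        by (simp only: image_comp[symmetric] r(2) image_inv_f_f[OF permutes_inj[OF s]])
      then have "inv_into UNIV \<sigma> \<circ> \<rho> \<in> ?H"
        unfolding H using permutes_compose[OF r(1) permutes_inv[OF s]] by blast
      moreover have "\<rho> = \<sigma> \<circ> (inv_into UNIV \<sigma> \<circ> \<rho>)"
        unfolding comp_assoc[symmetric] permutes_inv_o(1)[OF s] by simp
      ultimately show "\<rho> \<in> (\<circ>) \<sigma> ` ?H" by blast
    qed
    finally show ?thesis .
  qed
  have "{\<sigma> ` J |\<sigma>. \<sigma> permutes ?X} = {S. S \<subseteq> ?X \<and> card S = card J}"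
  proof (rule Set.set_eqI, rule iffI)
    fix S assume "S \<in> {\<sigma> ` J |\<sigma>. \<sigma> permutes ?X}"
    then obtain \<sigma> where s: "\<sigma> permutes ?X" "S = \<sigma> ` J" by auto
    then have "S \<subseteq> \<sigma> ` ?X" by auto
    then show "S \<in> {S. S \<subseteq> ?X \<and> card S = card J}"
      using s by (simp add: permutes_image card_image permutes_inj_on)
  next
    fix S assume "S \<in> {S. S \<subseteq> ?X \<and> card S = card J}"
    then show "S \<in> {\<sigma> ` J |\<sigma>. \<sigma> permutes ?X}"
      using exists_permutes_image[of ?X J S] fin by auto
  qed
  moreover have "lcosets\<^bsub>block_perms (indiscrete ?X)\<^esub> ?H = ?C ` {\<sigma> ` J |\<sigma>. \<sigma> permutes ?X}"
    unfolding LCOSETS_def carrier_block_perms_indiscrete using coset by (auto simp: image_iff)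
  ultimately show ?thesis by simp
qed

section \<open>The transfer product with the one-block function over the rationals\<close>

text \<open>Infinite \<open>A\<close> is included, since both sums then take the default value
  zero.\<close>

lemma finsum_rat_ring: "finsum rat_ring f A = sum f A"
proof -
  interpret abelian_monoid rat_ring
    by (rule abelian_monoidI) (auto simp: algebra_simps)
  show ?thesis
    by (induction A rule: infinite_finite_induct) (simp_all add: finsum_infinite)
qed

text \<open>The setting of one induction step for the powers of \<open>c\<close>: \<open>x\<close>
  will be the degree \<open>i\<close> part of the \<open>n\<close>-th power, with
  \<open>u = fact n\<close>, and \<open>y\<close> the degree \<open>j\<close> part of
  \<open>c\<close>.\<close>

context
  fixes F :: "(nat, 's) species" and i j n :: nat
    and x y :: "(nat, 's) assembly \<Rightarrow> rat" and u :: rat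
  assumes F: "species F"
    and x: "\<And>a. a \<in> Asm F (std i) \<Longrightarrow> x a = (if card (fst a) = n then u else 0)"
    and y: "\<And>a. a \<in> Asm F (std j) \<Longrightarrow> y a = (if card (fst a) = 1 then 1 else 0)"
begin

interpretation species F by (rule F)

lemma act_shift:
  assumes "a \<in> Asm F (indiscrete {i+1..i+j})"
  shows "act F (indiscrete {i+1..i+j}) (\<lambda>k. i + k) y a = (if card (fst a) = 1 then 1 else 0)"
proof -
  let ?s = "inv_into UNIV (\<lambda>k. i + k)"
  have J: "{i+1..i+j} = (\<lambda>k. i + k) ` {1..j}" by simp
  \<comment> \<open>The shift is not surjective and \<open>?s\<close> is unspecified below
    \<open>i\<close>; the interval used here lies in the range of the shift.\<close>
  have inj: "inj_on ?s {i+1..i+j}" unfolding J by (intro inj_on_inv_into image_mono subset_UNIV)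
  have im: "?s ` {i+1..i+j} = {1..j}" unfolding J by (rule image_inv_f_f) simp
  have "relabel F ?s a \<in> Asm F ((`) ?s ` indiscrete {i+1..i+j})"
    using assms inj by (intro relabel_in_Asm) simp_all
  then have "relabel F ?s a \<in> Asm F (std j)"
    unfolding image_indiscrete im .
  moreover have "card ((`) ?s ` fst a) = card (fst a)"
    using partition_on_Asm[OF assms] inj by (intro card_image_image) (simp add: partition_on_def)
  ultimately show ?thesis using assms by (simp add: act_def y)
qed

text \<open>The second factor is nonzero only if the last \<open>j\<close> points form a single
  block. The first factor then sees all other blocks, and there are \<open>n\<close> of them exactly
  when \<open>b\<close> has \<open>Suc n\<close> blocks.\<close>

lemma ext_prod_eq:
  fixes b
  defines "\<Omega> \<equiv> indiscrete {1..i} \<union> indiscrete {i+1..i+j}"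
  assumes b: "b \<in> Asm F (std (i + j))"
  shows "extend_zero rat_ring F \<Omega> (std (i + j)) (ext_prod rat_ring F (std i) (indiscrete {i+1..i+j}) x
      (act F (indiscrete {i+1..i+j}) (\<lambda>k. i + k) y)) b
    = (if {i+1..i+j} \<in> fst b \<and> card (fst b) = Suc n then u else 0)"
proof -
  let ?I = "{1..i}" and ?J = "{i+1..i+j}"
  let ?P = "fst b"
  have P: "partition_on {1..i+j} ?P" using partition_on_Asm[OF b] by simp
  then have fin: "finite ?P" by (rule finite_elements[rotated]) simp
  have UO: "\<Union>\<Omega> = {1..i+j}" by (auto simp: \<Omega>_def)
  have O: "partition_on {1..i+j} \<Omega>"
    unfolding UO[symmetric] by (auto simp: \<Omega>_def indiscrete_eq partition_on_def disjoint_def)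
  show ?thesis
  proof (cases "b \<in> Asm F \<Omega>")
    case False
    \<comment> \<open>If the last \<open>j\<close> points formed a block, every other block would
      lie in the first \<open>i\<close> points and \<open>b\<close> would refine
      \<open>\<Omega>\<close>, against the case assumption.\<close>
    have "?J \<notin> ?P"
    proof
      assume J: "?J \<in> ?P"
      have "B \<subseteq> ?I \<and> ?I \<in> \<Omega>" if B: "B \<in> ?P" "B \<noteq> ?J" for B
      proof -
        have "B \<inter> ?J = {}" using P J B by (auto simp: partition_on_def disjoint_def)
        moreover have "B \<subseteq> {1..i+j}" "B \<noteq> {}" using P B by (auto simp: partition_on_def)
        ultimately have "B \<subseteq> ?I" by (force simp: disjoint_iff subset_iff)
        with \<open>B \<noteq> {}\<close> show ?thesis by (auto simp: \<Omega>_def indiscrete_eq)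
      qed
      moreover have "?J \<in> \<Omega>" using P J by (auto simp: \<Omega>_def indiscrete_eq partition_on_def)
      ultimately have "refines {1..i+j} ?P \<Omega>"
        unfolding refines_def using P O by blast
      then show False using False Asm_coarsen_iff[OF b, of \<Omega>] UO by simp
    qed
    then show ?thesis using False b by (simp add: extend_zero_def)
  next
    case True
    let ?b1 = "asm_restrict ?I b" and ?b2 = "asm_restrict ?J b"
    have r: "?b1 \<in> Asm F (std i)" "?b2 \<in> Asm F (indiscrete ?J)"
      using asm_restrict_in_Asm[OF True, of "std i"] asm_restrict_in_Asm[OF True, of "indiscrete ?J"]
      by (simp_all add: \<Omega>_def)
    have f: "fst ?b1 = {B \<in> ?P. B \<subseteq> ?I}" "fst ?b2 = {B \<in> ?P. B \<subseteq> ?J}"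
      by (simp_all add: asm_restrict_def split_beta)
    \<comment> \<open>Refining \<open>\<Omega>\<close> puts each block on one of the two sides; by
      nonemptiness it is on one only, so the numbers of blocks add up.\<close>
    have un: "?P = fst ?b1 \<union> fst ?b2"
    proof -
      have "\<exists>Y\<in>\<Omega>. B \<subseteq> Y" if "B \<in> ?P" for B
        using True that by (auto simp: Asm_def refines_def)
      then show ?thesis unfolding f by (force simp: \<Omega>_def indiscrete_eq split: if_splits)
    qed
    have disj: "fst ?b1 \<inter> fst ?b2 = {}"
    proof -
      have "B = {}" if "B \<subseteq> ?I" "B \<subseteq> ?J" for B using that by force
      then show ?thesis unfolding f using partition_onD3[OF P] by blast
    qed
    have card: "card ?P = card (fst ?b1) + card (fst ?b2)"
      using card_Un_disjoint[OF _ _ disj] un fin by (metis finite_Un)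
    \<comment> \<open>For \<open>j = 0\<close> the set \<open>?J\<close> is empty and hence no
      block, and the second factor vanishes accordingly.\<close>
    have one: "card (fst ?b2) = 1 \<longleftrightarrow> ?J \<in> ?P"
    proof -
      have "partition_on ?J (fst ?b2)" using partition_on_Asm[OF r(2)] by simp
      moreover have "?J \<in> ?P \<longleftrightarrow> ?J \<in> fst ?b2" unfolding f by blast
      ultimately show ?thesis using card_eq_1_partition_iff by blast
    qed
    show ?thesis
      using b True act_shift[OF r(2)] x[OF r(1)] one card
      by (auto simp: extend_zero_def ext_prod_def \<Omega>_def)
  qed
qed

text \<open>The cosets give one term for each \<open>j\<close>-element subset \<open>S\<close>. A
  representative carries \<open>?J\<close> to \<open>S\<close>, so after relabelling along its
  inverse \<open>?J\<close> is a block exactly when \<open>S\<close> is a block of \<open>a\<close>,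
  and \<open>ext_prod_eq\<close> evaluates the term.\<close>

lemma transfer_prod_eq:
  assumes a: "a \<in> Asm F (std (i + j))"
  shows "transfer_prod rat_ring F i j x y a
    = of_nat (card {S \<in> fst a. card S = j}) * (if card (fst a) = Suc n then u else 0)"
proof -
  let ?I = "{1..i}" and ?J = "{i+1..i+j}"
  let ?\<Omega> = "indiscrete ?I \<union> indiscrete ?J"
  let ?\<phi> = "extend_zero rat_ring F ?\<Omega> (std (i + j))
    (ext_prod rat_ring F (std i) (indiscrete ?J) x (act F (indiscrete ?J) (\<lambda>k. i + k) y))"
  let ?C = "\<lambda>S. {\<rho>. \<rho> permutes {1..i+j} \<and> \<rho> ` ?J = S}"
  let ?Ss = "{S. S \<subseteq> {1..i+j} \<and> card S = j}"
  let ?v = "if card (fst a) = Suc n then u else 0"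
  have IJ: "?I \<union> ?J = {1..i+j}" by auto
  have cos: "lcosets\<^bsub>block_perms (std (i + j))\<^esub> (carrier (block_perms ?\<Omega>)) = ?C ` ?Ss"
    using lcosets_block_perms[of ?I ?J] unfolding IJ by simp
  \<comment> \<open>Nonemptiness provides a representative and lets \<open>S\<close> be recovered
    from its coset, so that the sum can be reindexed by subsets.\<close>
  have ne: "\<exists>\<rho>. \<rho> \<in> ?C S" if "S \<in> ?Ss" for S
    using exists_permutes_image[of "{1..i+j}" ?J S] that by auto
  have inj: "inj_on ?C ?Ss" using ne by (intro inj_onI) blast
  have P: "partition_on {1..i+j} (fst a)" using partition_on_Asm[OF a] by simp
  have val: "act F (std (i + j)) (SOME \<sigma>. \<sigma> \<in> ?C S) ?\<phi> a = (if S \<in> fst a then ?v else 0)"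
    if S: "S \<in> ?Ss" for S
  proof -
    define \<sigma> where "\<sigma> = (SOME \<sigma>. \<sigma> \<in> ?C S)"
    have "\<sigma> \<in> ?C S" unfolding \<sigma>_def using ne[OF S] by (rule someI_ex)
    then have s: "\<sigma> permutes {1..i+j}" "\<sigma> ` ?J = S" by auto
    let ?b = "relabel F (inv_into UNIV \<sigma>) a"
    have b: "?b \<in> Asm F (std (i + j))" using relabel_inv_in_Asm[OF a _ s(1)] by simp
    have "?J \<in> fst ?b \<longleftrightarrow> S \<in> fst a"
    proof -
      have J: "?J = inv_into UNIV \<sigma> ` S"
        unfolding s(2)[symmetric] by (rule image_inv_f_f[symmetric]) (rule permutes_inj[OF s(1)])
      have "inj (inv_into UNIV \<sigma>)" using permutes_inj[OF permutes_inv[OF s(1)]] .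
      then show ?thesis unfolding J by (simp add: image_iff inj_image_eq_iff)
    qed
    moreover have "card (fst ?b) = card (fst a)"
      using permutes_inj_on[OF permutes_inv[OF s(1)]] by (simp add: card_image_image)
    ultimately show ?thesis
      using a ext_prod_eq[OF b] unfolding \<sigma>_def[symmetric] by (simp add: act_def)
  qed
  have "transfer_prod rat_ring F i j x y a
    = (\<Sum>C\<in>?C ` ?Ss. act F (std (i + j)) (SOME \<sigma>. \<sigma> \<in> C) ?\<phi> a)"
    using a cos by (simp add: transfer_prod_def transfer_def finsum_rat_ring Let_def)
  also have "\<dots> = (\<Sum>S\<in>?Ss. if S \<in> fst a then ?v else 0)"
    using val by (subst sum.reindex[OF inj]) (simp add: comp_def)
  also have "\<dots> = (\<Sum>S\<in>{S \<in> ?Ss. S \<in> fst a}. ?v)"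
    by (intro sum.inter_filter[symmetric]) simp
  also have "{S \<in> ?Ss. S \<in> fst a} = {S \<in> fst a. card S = j}"
    using partition_onD1[OF P] by blast
  finally show ?thesis by simp
qed

end

section \<open>The series \<open>c\<close> and \<open>g\<close> under change of coefficients\<close>

lemma char_fun_eq:
  assumes "structs F {} = {}"
  shows "char_fun K F m = (\<lambda>a\<in>Asm F (std m). if card (fst a) = 1 then \<one>\<^bsub>K\<^esub> else \<zero>\<^bsub>K\<^esub>)"
proof
  fix a show "char_fun K F m a
    = (\<lambda>a\<in>Asm F (std m). if card (fst a) = 1 then \<one>\<^bsub>K\<^esub> else \<zero>\<^bsub>K\<^esub>) a"
  proof (cases "a \<in> Asm F (std m)")
    case True
    show ?thesis unfolding char_fun_def restrict_apply one_block_iff[OF True assms] ..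
  qed (simp add: char_fun_def)
qed

text \<open>Without structures on the empty set the characteristic function already vanishes in
  degree 0, in accord with the series starting at \<open>i = 1\<close>.\<close>

lemma c_series_eq:
  assumes "structs F {} = {}"
  shows "c_series K F m = char_fun K F m"
proof (cases m)
  case 0
  have "one_block F {} = {}" using assms by (simp add: one_block_def)
  then show ?thesis using 0 by (simp add: c_series_def series_ring_def char_fun_def)
qed (simp add: c_series_def)

lemma base_change_c_series:
  assumes "cring K" "structs F {} = {}"
  shows "base_change K F (c_series \<Z> F) = c_series K F"
proof -
  interpret cring K by fact
  have "[(0::int)] \<cdot>\<^bsub>K\<^esub> \<one>\<^bsub>K\<^esub> = \<zero>\<^bsub>K\<^esub>" by (simp add: add_pow_def)
  then show ?thesis
    by (intro ext) (simp add: base_change_def c_series_eq[OF assms(2)] char_fun_def cong: restrict_cong)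
qed

lemma base_change_g_series:
  assumes "cring K"
  shows "base_change K F (g_series \<Z> F) = g_series K F"
proof -
  interpret cring K by fact
  show ?thesis
    unfolding base_change_def g_series_def const_one_def by (rule ext, rule restrict_ext) simp
qed

lemma cring_rat_ring: "cring rat_ring"
proof (rule cringI)
  show "abelian_group rat_ring"
    by (rule abelian_groupI) (auto intro: exI[of _ "- _"] simp: algebra_simps)
  show "comm_monoid rat_ring" by (rule comm_monoidI) auto
qed (auto simp: algebra_simps)

text \<open>Turns base change to \<open>rat_ring\<close> into coefficientwise
  \<open>of_int\<close>.\<close>

lemma of_int_rat_ring: "[k] \<cdot>\<^bsub>rat_ring\<^esub> (1::rat) = of_int k" for k :: int
proof -
  interpret cring rat_ring by (rule cring_rat_ring)
  have nat: "[n] \<cdot>\<^bsub>rat_ring\<^esub> (1::rat) = of_nat n" for n :: nat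
    by (induction n) (simp_all add: add_pow_def nat_pow_def)
  have minus: "\<ominus>\<^bsub>rat_ring\<^esub> q = - q" for q
    using minus_equality[of "- q" q] by simp
  show ?thesis
  proof (cases "0 \<le> k")
    case True
    then show ?thesis by (simp add: add_pow_int_ge nat)
  next
    case False
    then show ?thesis by (simp add: add_pow_int_lt nat minus)
  qed
qed

text \<open>Integers embed into the rationals, and outside the assemblies all coefficient functions
  share the value \<open>undefined\<close>. This gives the uniqueness behind the \<open>THE\<close>
  in \<open>int_exp\<close>.\<close>

lemma inj_on_base_change_rat:
  "inj_on (base_change rat_ring F) (carrier (series_ring \<Z> F))"
proof (rule inj_onI, rule ext, rule ext)
  fix x y m a
  assume x: "x \<in> carrier (series_ring \<Z> F)" and y: "y \<in> carrier (series_ring \<Z> F)"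
    and eq: "base_change rat_ring F x = base_change rat_ring F y"
  show "x m a = y m a"
  proof (cases "a \<in> Asm F (std m)")
    case True
    then show ?thesis using fun_cong[OF fun_cong[OF eq, of m], of a]
      by (simp add: base_change_def of_int_rat_ring)
  next
    case False
    have "x m \<in> Asm F (std m) \<rightarrow>\<^sub>E carrier \<Z>" "y m \<in> Asm F (std m) \<rightarrow>\<^sub>E carrier \<Z>"
      using x y by (simp_all add: series_ring_def inv_funs_def)
    then show ?thesis using False by (metis PiE_arb)
  qed
qed

section \<open>Powers of \<open>c\<close> and the exponential\<close>

text \<open>Induction on \<open>n\<close>: the new factor \<open>c\<close> takes any one block and
  the \<open>n\<close>-th power sees the remaining ones, so the value gets multiplied by the number
  of blocks.\<close>

lemma c_series_power:
  fixes F :: "(nat, 's) species"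
  assumes F: "species F" "structs F {} = {}" and a: "a \<in> Asm F (std m)"
  shows "(c_series rat_ring F [^]\<^bsub>series_ring rat_ring F\<^esub> n) m a
    = (if card (fst a) = n then fact n else 0)"
  using a
proof (induction n arbitrary: m a)
  case 0
  then have P: "partition_on {1..m} (fst a)" by (simp add: Asm_indiscrete_iff)
  then have "finite (fst a)" by (rule finite_elements[rotated]) simp
  \<comment> \<open>Only the empty set has a partition without blocks, matching the unit series,
    which is concentrated in degree 0.\<close>
  then have "card (fst a) = 0 \<longleftrightarrow> m = 0"
    using P by (auto simp: partition_on_def)
  then show ?case using 0 by (simp add: nat_pow_def series_ring_def)
next
  case (Suc n)
  let ?c = "c_series rat_ring F"
  let ?p = "?c [^]\<^bsub>series_ring rat_ring F\<^esub> n"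
  let ?P = "fst a"
  let ?v = "if card ?P = Suc n then fact n else 0 :: rat"
  have P: "partition_on {1..m} ?P" using Suc.prems by (simp add: Asm_indiscrete_iff)
  then have fin: "finite ?P" by (rule finite_elements[rotated]) simp
  have le: "card S \<le> m" if "S \<in> ?P" for S
    using card_mono[of "{1..m}" S] partition_onD1[OF P] that by auto
  have "(?c [^]\<^bsub>series_ring rat_ring F\<^esub> Suc n) m a
    = (\<Sum>i\<le>m. transfer_prod rat_ring F i (m - i) (?p i) (?c (m - i)) a)"
    using Suc.prems by (simp add: nat_pow_def series_ring_def finsum_rat_ring)
  also have "\<dots> = (\<Sum>i\<le>m. of_nat (card {S \<in> ?P. card S = m - i}) * ?v)"
  proof (rule sum.cong[OF refl])
    fix i assume "i \<in> {..m}"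
    then have "a \<in> Asm F (std (i + (m - i)))" using Suc.prems by simp
    then show "transfer_prod rat_ring F i (m - i) (?p i) (?c (m - i)) a
        = of_nat (card {S \<in> ?P. card S = m - i}) * ?v"
      by (intro transfer_prod_eq[OF F(1)] Suc.IH)
        (simp_all add: c_series_eq[OF F(2)] char_fun_eq[OF F(2)])
  qed
  also have "\<dots> = of_nat (\<Sum>i\<le>m. card {S \<in> ?P. card S = m - i}) * ?v"
    by (simp add: sum_distrib_right)
  \<comment> \<open>Every block has exactly one size, and it is at most \<open>m\<close>, so the sum
    over all sizes counts each block once.\<close>
  also have "(\<Sum>i\<le>m. card {S \<in> ?P. card S = m - i}) = (\<Sum>k\<le>m. card {S \<in> ?P. card S = k})"
    by (rule sum.reindex_bij_witness[of _ "\<lambda>k. m - k" "\<lambda>k. m - k"]) auto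
  also have "\<dots> = card ?P"
    using sum.group[OF fin, of "{..m}" card "\<lambda>_. 1 :: nat"] le by (auto simp: image_subset_iff)
  finally show ?case by simp
qed

lemma rat_exp_c_series:
  assumes "species F" "structs F {} = {}"
  shows "rat_exp F (c_series rat_ring F) = g_series rat_ring F"
proof (rule ext)
  fix m
  have "Sum_any (\<lambda>n. 1 / fact n * (c_series rat_ring F [^]\<^bsub>series_ring rat_ring F\<^esub> n) m a) = 1"
    if a: "a \<in> Asm F (std m)" for a
  proof -
    \<comment> \<open>Only the exponent equal to the number of blocks contributes, so the support is
      finite as \<open>Sum_any\<close> requires.\<close>
    have eq: "1 / fact n * (c_series rat_ring F [^]\<^bsub>series_ring rat_ring F\<^esub> n) m a
        = (if n = card (fst a) then 1 else 0)" for n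
      unfolding c_series_power[OF assms a] by (cases "n = card (fst a)") auto
    show ?thesis unfolding eq by (rule Sum_any.delta)
  qed
  then show "rat_exp F (c_series rat_ring F) m = g_series rat_ring F m"
    by (auto simp: rat_exp_def g_series_def const_one_def fun_eq_iff)
qed

theorem proposition16p5p1:
  fixes K :: "('k, 'z) ring_scheme" and F :: "(nat, 's) species"
  assumes "cring K" and "species F" and "structs F {} = {}"
  shows "(\<forall>m. const_one K F m \<in> inv_funs K F (std m)) \<and>
    (\<forall>m. char_fun K F m \<in> inv_funs K F (std m)) \<and>
    base_change K F (c_series \<Z> F) = c_series K F \<and>
    rat_exp F (base_change rat_ring F (c_series \<Z> F))
      \<in> base_change rat_ring F ` carrier (series_ring \<Z> F) \<and>
    g_series K F = series_exp K F (c_series \<Z> F)"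
proof (intro conjI allI)
  interpret species F by fact
  \<comment> \<open>Needed for \<open>K\<close> and again for the integers, hence an arbitrary
    coefficient ring.\<close>
  have one: "const_one L F m \<in> inv_funs L F (std m)" if "cring L"
    for L :: "('l, 'w) ring_scheme" and m
  proof -
    interpret L: cring L by fact
    show ?thesis
      using card_blocks_fun_in_inv_funs[of "\<lambda>_. \<one>\<^bsub>L\<^esub>" L "{1..m}"] by (simp add: const_one_def)
  qed
  show "const_one K F m \<in> inv_funs K F (std m)" for m using one assms(1) .
  show "char_fun K F m \<in> inv_funs K F (std m)" for m
  proof -
    interpret cring K by fact
    show ?thesis
      using card_blocks_fun_in_inv_funs[of "\<lambda>n. if n = 1 then \<one>\<^bsub>K\<^esub> else \<zero>\<^bsub>K\<^esub>" K "{1..m}"]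
      by (simp add: char_fun_eq[OF assms(3)])
  qed
  show "base_change K F (c_series \<Z> F) = c_series K F"
    using assms(1,3) by (rule base_change_c_series)
  have g: "g_series \<Z> F \<in> carrier (series_ring \<Z> F)"
    using one[OF int_is_cring] by (simp add: series_ring_def g_series_def)
  \<comment> \<open>Integrality of the exponential is shown by naming the integral lift, which is
    \<open>g\<close> itself.\<close>
  have exp: "base_change rat_ring F (g_series \<Z> F) = rat_exp F (base_change rat_ring F (c_series \<Z> F))"
    using assms by (simp add: base_change_c_series base_change_g_series cring_rat_ring rat_exp_c_series)
  then show "rat_exp F (base_change rat_ring F (c_series \<Z> F))
      \<in> base_change rat_ring F ` carrier (series_ring \<Z> F)"
    using imageI[OF g, of "base_change rat_ring F"] by simp
  \<comment> \<open>\<open>g\<close> has the defining property by \<open>exp\<close>, and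
    injectivity of the base change makes it the only such series.\<close>
  have "int_exp F (c_series \<Z> F) = g_series \<Z> F"
    unfolding int_exp_def exp[symmetric]
    by (rule the_equality) (use g inj_onD[OF inj_on_base_change_rat[of F]] in blast)+
  then show "g_series K F = series_exp K F (c_series \<Z> F)"
    by (simp add: series_exp_def base_change_g_series[OF assms(1)])
qed

end
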